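(* Let $S$ be a cancellative and right amenable monoid and $\rho$ a right $S$-action on a compact (Hausdorff) space $K$ by continuous self-maps. Let $\bar K=E(\rho)=\bigcap_{t\in S}\rho_t(K)$ be the surjective core of $\rho$ and let $\bar\rho$ be the right $S$-action on $\bar K$ obtained by restricting $\rho$. Then $h_{\mathrm{top}}(\rho)=h_{\mathrm{top}}(\bar\rho)$.
   Context: A cancellative monoid $S$ is right amenable if it admits a right F{\o}lner net, i.e. a net $\{F_i\}_{i\in I}$ of non-empty finite subsets of $S$ such that $\lim_{i\in I}|F_is\setminus F_i|/|F_i|=0$ for every $s\in S$. A right $S$-action $\rho$ on a compact space $K$ is a family of continuous self-maps $\rho_s$ with $\rho_1=\mathrm{id}_K$, $\rho_{st}=\rho_t\circ\rho_s$. The subspace $\bar K=E(\rho)$ is closed in $K$ and $\rho_s(\bar K)=\bar K$ for every $s\in S$; $\bar\rho_s=\rho_s|_{\bar K}$. Topological entropy: for an open cover $\mathcal U$ of $K$ let $N(\mathcal U)$ be the minimal cardinality of a subcover; $\mathcal U\vee\mathcal V=\{U\cap V:U\in\mathcal U,V\in\mathcal V\}$; $\mathcal U_{\rho,F}=\bigvee_{s\in F}\rho_s^{-1}(\mathcal U)$ for non-empty finite $F\subseteq S$. For a right F{\o}lner net $\{F_i\}$ of $S$ put $H_{\mathrm{top}}(\rho,\mathcal U)=\lim_i\frac{\log N(\mathcal U_{\rho,F_i})}{|F_i|}$ (the limit exists and does not depend on the net), and $h_{\mathrm{top}}(\rho)=\sup_{\mathcal U}H_{\mathrm{top}}(\rho,\mathcal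 U)\in[0,\infty]$ over all open covers. *)

theory Defs
  imports "HOL-Analysis.Analysis"
begin

section \<open>Cancellative monoids and right Foelner nets\<close>

class cancellative_monoid = monoid_mult +
  assumes mult_left_cancellative: "a * b = a * c \<Longrightarrow> b = c"
    and mult_right_cancellative: "b * a = c * a \<Longrightarrow> b = c"

definition directed_preorder_on :: "'i set \<Rightarrow> 'i rel \<Rightarrow> bool" where
  "directed_preorder_on I r \<longleftrightarrow>
     I \<noteq> {} \<and> preorder_on I r \<and> (\<forall>i\<in>I. \<forall>j\<in>I. \<exists>k\<in>I. (i, k) \<in> r \<and> (j, k) \<in> r)"

text \<open>The filter of tails of a directed set; a net \<open>f\<close> indexed by \<open>I\<close> converges to \<open>l\<close>
  iff \<open>(f \<longlongrightarrow> l) (net_filter I r)\<close>.\<close>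

definition net_filter :: "'i set \<Rightarrow> 'i rel \<Rightarrow> 'i filter" where
  "net_filter I r = (INF i\<in>I. principal {j \<in> I. (i, j) \<in> r})"

lemma eventually_net_filter:
  assumes "directed_preorder_on I r"
  shows "eventually P (net_filter I r) \<longleftrightarrow> (\<exists>i\<in>I. \<forall>j\<in>I. (i, j) \<in> r \<longrightarrow> P j)"
  unfolding net_filter_def
proof (subst eventually_INF_base)
  show "I \<noteq> {}" using assms by (simp add: directed_preorder_on_def)
next
  fix i j assume "i \<in> I" "j \<in> I"
  then obtain k where "k \<in> I" "(i, k) \<in> r" "(j, k) \<in> r"
    using assms unfolding directed_preorder_on_def by blast
  moreover have "trans r" using assms by (simp add: directed_preorder_on_def preorder_on_def)
  ultimately show "\<exists>x\<in>I. principal {j \<in> I. (x, j) \<in> r}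
      \<le> inf (principal {j \<in> I. (i, j) \<in> r}) (principal {ja \<in> I. (j, ja) \<in> r})"
    by (intro bexI[of _ k]) (auto dest: transD)
qed (auto simp: eventually_principal)

definition right_Folner_net ::
    "'i set \<Rightarrow> 'i rel \<Rightarrow> ('i \<Rightarrow> 's::monoid_mult set) \<Rightarrow> bool" where
  "right_Folner_net I r F \<longleftrightarrow>
     directed_preorder_on I r \<and>
     (\<forall>i\<in>I. finite (F i) \<and> F i \<noteq> {}) \<and>
     (\<forall>s. ((\<lambda>i. real (card ((\<lambda>x. x * s) ` F i - F i)) / real (card (F i))) \<longlongrightarrow> 0)
            (net_filter I r))"

text \<open>HOL cannot quantify over index types inside a formula. Nets are therefore indexed by
  arbitrary directed subsets of the type \<^typ>\<open>'s set \<times> nat\<close>, which loses no generality: see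
  \<open>right_amenable_if_Folner_net\<close> and \<open>Folner_limit_any_index\<close> below.\<close>

definition right_amenable :: "'s::monoid_mult itself \<Rightarrow> bool" where
  "right_amenable _ \<longleftrightarrow>
     (\<exists>(I :: ('s set \<times> nat) set) r (F :: 's set \<times> nat \<Rightarrow> 's set). right_Folner_net I r F)"

definition is_Folner_limit :: "('s::monoid_mult set \<Rightarrow> real) \<Rightarrow> real \<Rightarrow> bool" where
  "is_Folner_limit \<phi> l \<longleftrightarrow>
     (\<forall>(I :: ('s set \<times> nat) set) r F. right_Folner_net I r F \<longrightarrow>
        ((\<lambda>i. \<phi> (F i)) \<longlongrightarrow> l) (net_filter I r))"

lemma Folner_net_reindex:
  fixes F :: "'i \<Rightarrow> 's::monoid_mult set"
  assumes F: "right_Folner_net I r F"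
    and P: "\<And>i. i \<in> I \<Longrightarrow> \<exists>j\<in>I. (i, j) \<in> r \<and> P (F j)"
  shows "\<exists>(J :: ('s set \<times> nat) set) q G. right_Folner_net J q G \<and> (\<forall>j\<in>J. P (G j))"
proof -
  define b :: "'s set \<Rightarrow> 's \<Rightarrow> real"
    where "b A s = real (card ((\<lambda>x. x * s) ` A - A)) / real (card A)" for A s
  have dir: "directed_preorder_on I r"
    and ne: "\<And>i. i \<in> I \<Longrightarrow> finite (F i) \<and> F i \<noteq> {}"
    and lim: "\<And>s. ((\<lambda>i. b (F i) s) \<longlongrightarrow> 0) (net_filter I r)"
    using F by (auto simp: right_Folner_net_def b_def)
  have b0: "b A s \<ge> 0" for A s by (simp add: b_def)
  have ex: "\<exists>A. finite A \<and> A \<noteq> {} \<and> P A \<and> (\<forall>s\<in>E. b A s < 1 / real (Suc n))"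
    if "finite E" for E :: "'s set" and n :: nat
  proof -
    have "eventually (\<lambda>i. b (F i) s < 1 / real (Suc n)) (net_filter I r)" for s
      using order_tendstoD(2)[OF lim] by simp
    then have "eventually (\<lambda>i. \<forall>s\<in>E. b (F i) s < 1 / real (Suc n)) (net_filter I r)"
      using that by (simp add: eventually_ball_finite)
    then obtain i where i: "i \<in> I"
        "\<And>j. j \<in> I \<Longrightarrow> (i, j) \<in> r \<Longrightarrow> \<forall>s\<in>E. b (F j) s < 1 / real (Suc n)"
      unfolding eventually_net_filter[OF dir] by blast
    obtain j where "j \<in> I" "(i, j) \<in> r" "P (F j)" using P i(1) by blast
    then show ?thesis using i(2) ne by (intro exI[of _ "F j"]) simp
  qed
  define J :: "('s set \<times> nat) set" where "J = {(E, n). finite E}"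
  define q :: "('s set \<times> nat) rel"
    where "q = {((E, n), (E', n')). finite E \<and> finite E' \<and> E \<subseteq> E' \<and> (n::nat) \<le> n'}"
  define G where "G p = (SOME A. finite A \<and> A \<noteq> {} \<and> P A \<and>
      (\<forall>s\<in>fst p. b A s < 1 / real (Suc (snd p))))" for p :: "'s set \<times> nat"
  have G: "finite (G p) \<and> G p \<noteq> {} \<and> P (G p) \<and> (\<forall>s\<in>fst p. b (G p) s < 1 / real (Suc (snd p)))"
    if "p \<in> J" for p
    unfolding G_def by (rule someI_ex, rule ex) (use that in \<open>auto simp: J_def\<close>)
  have dirJ: "directed_preorder_on J q"
    unfolding directed_preorder_on_def preorder_on_def
  proof (intro conjI ballI)
    show "J \<noteq> {}" by (auto simp: J_def intro: exI[of _ "{}"])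
    show "q \<subseteq> J \<times> J" "refl_on J q" "trans q"
      by (auto simp: J_def q_def refl_on_def trans_def)
    fix x y assume "x \<in> J" "y \<in> J"
    then show "\<exists>k\<in>J. (x, k) \<in> q \<and> (y, k) \<in> q"
      by (intro bexI[of _ "(fst x \<union> fst y, max (snd x) (snd y))"]) (auto simp: J_def q_def)
  qed
  have "((\<lambda>p. b (G p) s) \<longlongrightarrow> 0) (net_filter J q)" for s
  proof (rule tendstoI)
    fix e :: real assume "e > 0"
    then obtain n where n: "1 / real (Suc n) < e" using nat_approx_posE by metis
    have "dist (b (G p) s) 0 < e" if p: "p \<in> J" "(({s}, n), p) \<in> q" for p
    proof -
      have "s \<in> fst p" "n \<le> snd p" using p by (auto simp: q_def)
      then have "b (G p) s < 1 / real (Suc (snd p))" "1 / real (Suc (snd p)) \<le> 1 / real (Suc n)"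
        using G[OF p(1)] by (auto simp: frac_le)
      then show ?thesis using n b0[of "G p" s] by (simp add: dist_real_def)
    qed
    moreover have "({s}, n) \<in> J" by (simp add: J_def)
    ultimately show "eventually (\<lambda>p. dist (b (G p) s) 0 < e) (net_filter J q)"
      unfolding eventually_net_filter[OF dirJ] by blast
  qed
  then have "right_Folner_net J q G"
    using dirJ G unfolding right_Folner_net_def b_def by blast
  then show ?thesis using G by blast
qed

lemma right_amenable_if_Folner_net:
  fixes F :: "'i \<Rightarrow> 's::monoid_mult set"
  assumes "right_Folner_net I r F"
  shows "right_amenable TYPE('s)"
proof -
  have "refl_on I r"
    using assms by (simp add: right_Folner_net_def directed_preorder_on_def preorder_on_def)
  then show ?thesis
    using Folner_net_reindex[OF assms, of "\<lambda>_. True"]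
    unfolding right_amenable_def by (meson refl_onD)
qed

lemma Folner_limit_any_index:
  fixes F :: "'i \<Rightarrow> 's::monoid_mult set"
  assumes F: "right_Folner_net I r F" and l: "is_Folner_limit \<phi> l"
  shows "((\<lambda>i. \<phi> (F i)) \<longlongrightarrow> l) (net_filter I r)"
proof (rule tendstoI, rule ccontr)
  fix e :: real
  assume e: "e > 0" and "\<not> eventually (\<lambda>i. dist (\<phi> (F i)) l < e) (net_filter I r)"
  moreover have "directed_preorder_on I r" using F by (simp add: right_Folner_net_def)
  ultimately have "\<And>i. i \<in> I \<Longrightarrow> \<exists>j\<in>I. (i, j) \<in> r \<and> \<not> dist (\<phi> (F j)) l < e"
    by (auto simp: eventually_net_filter)
  then obtain J :: "('s set \<times> nat) set" and q G
    where G: "right_Folner_net J q G" "\<forall>j\<in>J. \<not> dist (\<phi> (G j)) l < e"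
    using Folner_net_reindex[OF F, of "\<lambda>A. \<not> dist (\<phi> A) l < e"] by blast
  have "((\<lambda>i. \<phi> (G i)) \<longlongrightarrow> l) (net_filter J q)"
    using l G(1) by (simp add: is_Folner_limit_def)
  then have "eventually (\<lambda>j. dist (\<phi> (G j)) l < e) (net_filter J q)"
    using e by (rule tendstoD)
  moreover have dirJ: "directed_preorder_on J q" using G(1) by (simp add: right_Folner_net_def)
  ultimately obtain j where "j \<in> J" "\<forall>k\<in>J. (j, k) \<in> q \<longrightarrow> dist (\<phi> (G k)) l < e"
    by (auto simp: eventually_net_filter)
  moreover have "refl_on J q"
    using dirJ by (simp add: directed_preorder_on_def preorder_on_def)
  ultimately show False using G(2) by (meson refl_onD)
qed


section \<open>Right actions and the surjective core\<close>

definition right_action :: "'k topology \<Rightarrow> ('s::monoid_mult \<Rightarrow> 'k \<Rightarrow> 'k) \<Rightarrow> bool" where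
  "right_action X \<rho> \<longleftrightarrow>
     (\<forall>s. continuous_map X X (\<rho> s)) \<and>
     (\<forall>x\<in>topspace X. \<rho> 1 x = x) \<and>
     (\<forall>s t. \<forall>x\<in>topspace X. \<rho> (s * t) x = \<rho> t (\<rho> s x))"

definition surjective_core :: "'k topology \<Rightarrow> ('s \<Rightarrow> 'k \<Rightarrow> 'k) \<Rightarrow> 'k set" where
  "surjective_core X \<rho> = (\<Inter>t. \<rho> t ` topspace X)"

definition restrict_action :: "('s \<Rightarrow> 'k \<Rightarrow> 'k) \<Rightarrow> 'k set \<Rightarrow> 's \<Rightarrow> 'k \<Rightarrow> 'k" where
  "restrict_action \<rho> A = (\<lambda>s. restrict (\<rho> s) A)"


section \<open>Topological entropy\<close>

definition open_cover :: "'k topology \<Rightarrow> 'k set set \<Rightarrow> bool" where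
  "open_cover X \<U> \<longleftrightarrow> (\<forall>U\<in>\<U>. openin X U) \<and> \<Union>\<U> = topspace X"

text \<open>Only finite subcovers are considered because \<^const>\<open>card\<close> is 0 on infinite sets; on a
  compact space every open cover has one.\<close>

definition cover_number :: "'k topology \<Rightarrow> 'k set set \<Rightarrow> nat" where
  "cover_number X \<U> = (LEAST n. \<exists>\<V>\<subseteq>\<U>. finite \<V> \<and> \<Union>\<V> = topspace X \<and> card \<V> = n)"

definition cover_join :: "'k set set \<Rightarrow> 'k set set \<Rightarrow> 'k set set" where
  "cover_join \<U> \<V> = {U \<inter> V | U V. U \<in> \<U> \<and> V \<in> \<V>}"

definition cover_Join :: "'s set \<Rightarrow> ('s \<Rightarrow> 'k set set) \<Rightarrow> 'k set set" where
  "cover_Join F \<W> = {\<Inter>s\<in>F. A s | A. \<forall>s\<in>F. A s \<in> \<W> s}"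

lemma cover_Join_singleton: "cover_Join {s} \<W> = \<W> s"
  unfolding cover_Join_def by (auto intro: exI[of _ "\<lambda>_. _"])

lemma cover_Join_insert:
  assumes "s \<notin> F"
  shows "cover_Join (insert s F) \<W> = cover_join (\<W> s) (cover_Join F \<W>)" (is "?L = ?R")
proof
  show "?L \<subseteq> ?R"
  proof
    fix W assume "W \<in> ?L"
    then obtain A where A: "W = A s \<inter> (\<Inter>t\<in>F. A t)" "A s \<in> \<W> s" "\<forall>t\<in>F. A t \<in> \<W> t"
      unfolding cover_Join_def by auto
    then have "(\<Inter>t\<in>F. A t) \<in> cover_Join F \<W>" unfolding cover_Join_def by blast
    then show "W \<in> ?R" using A unfolding cover_join_def by blast
  qed
next
  show "?R \<subseteq> ?L"
  proof
    fix W assume "W \<in> ?R"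
    then obtain U V where UV: "W = U \<inter> V" "U \<in> \<W> s" "V \<in> cover_Join F \<W>"
      unfolding cover_join_def by blast
    then obtain A where "V = (\<Inter>t\<in>F. A t)" "\<forall>t\<in>F. A t \<in> \<W> t"
      unfolding cover_Join_def by blast
    with UV have W: "W = U \<inter> (\<Inter>t\<in>F. A t)" "U \<in> \<W> s" "\<forall>t\<in>F. A t \<in> \<W> t"
      by auto
    define B where "B = A(s := U)"
    have B: "B s = U" "\<And>t. t \<in> F \<Longrightarrow> B t = A t" using assms by (auto simp: B_def)
    have "W = (\<Inter>t\<in>insert s F. B t)" "\<forall>t\<in>insert s F. B t \<in> \<W> t"
      using W B by simp_all
    then show "W \<in> ?L" unfolding cover_Join_def by blast
  qed
qed

definition preimage_cover :: "'k topology \<Rightarrow> ('k \<Rightarrow> 'k) \<Rightarrow> 'k set set \<Rightarrow> 'k set set" where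
  "preimage_cover X f \<U> = {{x \<in> topspace X. f x \<in> U} | U. U \<in> \<U>}"

definition action_cover ::
    "'k topology \<Rightarrow> ('s \<Rightarrow> 'k \<Rightarrow> 'k) \<Rightarrow> 'k set set \<Rightarrow> 's set \<Rightarrow> 'k set set" where
  "action_cover X \<rho> \<U> F = cover_Join F (\<lambda>s. preimage_cover X (\<rho> s) \<U>)"

text \<open>The common limit along all right Foelner nets; it exists and is unique for cancellative
  right amenable \<open>'s\<close>, compact \<open>X\<close> and right actions (Ornstein--Weiss).\<close>

definition H_top ::
    "'k topology \<Rightarrow> ('s::monoid_mult \<Rightarrow> 'k \<Rightarrow> 'k) \<Rightarrow> 'k set set \<Rightarrow> real" where
  "H_top X \<rho> \<U> =
     (THE h. is_Folner_limit
        (\<lambda>F. ln (real (cover_number X (action_cover X \<rho> \<U> F))) / real (card F)) h)"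

definition h_top :: "'k topology \<Rightarrow> ('s::monoid_mult \<Rightarrow> 'k \<Rightarrow> 'k) \<Rightarrow> ereal" where
  "h_top X \<rho> = (SUP \<U>\<in>{\<U>. open_cover X \<U>}. ereal (H_top X \<rho> \<U>))"

end

theory Submission
  imports Defs
begin

text \<open>For an open cover \<open>\<U>\<close> of \<open>X\<close>, the functions \<open>f F = ln N(\<U>\<^bsub>\<rho>,F\<^esub>)\<close> and \<open>g F\<close>, its analogue for the
  restriction of \<open>\<rho>\<close> and \<open>\<U>\<close> to the core, satisfy \<open>g F \<le> f F\<close>. Conversely, a cover of the core by
  members of \<open>\<U>\<^bsub>\<rho>,F\<^esub>\<close> covers a neighbourhood of it, hence by compactness some \<open>\<rho> t (X)\<close>, so that
  \<open>f (t F) \<le> g F\<close>. Left translates of a right Foelner net form a right Foelner net, so once \<open>f F / |F|\<close>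
  converges along all such nets (the Ornstein--Weiss lemma), \<open>g F / |F|\<close> converges to the same limit.\<close>

section \<open>Almost invariant sets\<close>

text \<open>Trades nets for finite conditions: a right Foelner net eventually meets each of them, so
  limits along all nets reduce to estimates for all sufficiently invariant sets.\<close>

definition almost_invariant :: "'s::monoid_mult set \<Rightarrow> real \<Rightarrow> 's set \<Rightarrow> bool" where
  "almost_invariant K \<eta> F \<longleftrightarrow> finite F \<and> F \<noteq> {} \<and>
     (\<forall>s\<in>K. real (card ((\<lambda>x. x * s) ` F - F)) \<le> \<eta> * real (card F))"

lemma almost_invariant_mono:
  "almost_invariant K \<eta> F \<Longrightarrow> K' \<subseteq> K \<Longrightarrow> \<eta> \<le> \<eta>' \<Longrightarrow> almost_invariant K' \<eta>' F"
  unfolding almost_invariant_def by (meson mult_right_mono of_nat_0_le_iff order_trans subsetD)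

lemma eventually_almost_invariant:
  assumes F: "right_Folner_net I r F" and K: "finite K" and "\<eta> > 0"
  shows "eventually (\<lambda>i. almost_invariant K \<eta> (F i)) (net_filter I r)"
proof -
  have dir: "directed_preorder_on I r"
    and ne: "\<And>i. i \<in> I \<Longrightarrow> finite (F i) \<and> F i \<noteq> {}"
    and lim: "\<And>s. ((\<lambda>i. real (card ((\<lambda>x. x * s) ` F i - F i)) / real (card (F i))) \<longlongrightarrow> 0)
            (net_filter I r)"
    using F by (auto simp: right_Folner_net_def)
  have "eventually (\<lambda>i. \<forall>s\<in>K. real (card ((\<lambda>x. x * s) ` F i - F i)) / real (card (F i)) < \<eta>)
      (net_filter I r)"
    using K order_tendstoD(2)[OF lim \<open>\<eta> > 0\<close>] by (simp add: eventually_ball_finite)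
  moreover have "eventually (\<lambda>i. i \<in> I) (net_filter I r)"
    using dir unfolding eventually_net_filter[OF dir] directed_preorder_on_def by blast
  ultimately show ?thesis
  proof eventually_elim
    case (elim i)
    then have "card (F i) > 0" using ne by (simp add: card_gt_0_iff)
    with elim ne show ?case
      unfolding almost_invariant_def by (auto simp: field_simps intro: less_imp_le)
  qed
qed

lemma net_filter_neq_bot:
  assumes "directed_preorder_on I r"
  shows "net_filter I r \<noteq> bot"
proof
  assume "net_filter I r = bot"
  then have "eventually (\<lambda>_. False) (net_filter I r)" by simp
  then obtain i where "i \<in> I" "\<forall>j\<in>I. (i, j) \<notin> r"
    unfolding eventually_net_filter[OF assms] by blast
  moreover have "refl_on I r" using assms by (simp add: directed_preorder_on_def preorder_on_def)
  ultimately show False by (meson refl_onD)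
qed

lemma right_amenableE:
  assumes "right_amenable TYPE('s::monoid_mult)"
  obtains I :: "('s::monoid_mult set \<times> nat) set" and r and F :: "_ \<Rightarrow> 's set"
  where "right_Folner_net I r F"
    "net_filter I r \<noteq> bot"
  using assms net_filter_neq_bot unfolding right_amenable_def right_Folner_net_def by blast

lemma ex_almost_invariant:
  fixes K :: "'s::monoid_mult set"
  assumes "right_amenable TYPE('s)" "finite K" "\<eta> > 0"
  obtains F where "almost_invariant K \<eta> F"
proof -
  obtain I :: "('s set \<times> nat) set" and r and F :: "_ \<Rightarrow> 's set"
    where F: "right_Folner_net I r F" "net_filter I r \<noteq> bot"
    using right_amenableE[OF assms(1)] by blast
  show ?thesis
    using eventually_happens'[OF F(2) eventually_almost_invariant[OF F(1) assms(2,3)]] that by blast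
qed

section \<open>Translates and common left multiples in a cancellative monoid\<close>

lemma inj_mult_left: "inj_on (\<lambda>x. t * x) (A :: 's::cancellative_monoid set)"
  by (auto simp: inj_on_def dest: mult_left_cancellative)

lemma inj_mult_right: "inj_on (\<lambda>x. x * t) (A :: 's::cancellative_monoid set)"
  by (auto simp: inj_on_def dest: mult_right_cancellative)

lemma card_mult_left [simp]: "card ((*) t ` A) = card (A :: 's::cancellative_monoid set)"
  by (rule card_image) (rule inj_mult_left)

lemma card_mult_right [simp]: "card ((\<lambda>x. x * t) ` A) = card (A :: 's::cancellative_monoid set)"
  by (rule card_image) (rule inj_mult_right)

text \<open>By right cancellation \<open>F s\<close> and \<open>F t\<close> have as many elements as
  \<open>F\<close>, and each keeps at least two thirds of them inside \<open>F\<close>; hence they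
  meet. This Ore condition is what makes the ranges of the action directed.\<close>

lemma ex_common_left_multiple:
  fixes s t :: "'s::cancellative_monoid"
  assumes "right_amenable TYPE('s)"
  shows "\<exists>a b. a * s = b * t"
proof -
  obtain F where F: "almost_invariant {s, t} (1/3) F"
    using ex_almost_invariant[OF assms, of "{s, t}" "1/3"] by auto
  then have fin: "finite F" and pos: "card F > 0"
    by (auto simp: almost_invariant_def card_gt_0_iff)
  let ?s = "(\<lambda>x. x * s) ` F" and ?t = "(\<lambda>x. x * t) ` F"
  have "?s \<inter> ?t \<noteq> {}"
  proof
    assume "?s \<inter> ?t = {}"
    have s: "card F = card (?s \<inter> F) + card (?s - F)" and t: "card F = card (?t \<inter> F) + card (?t - F)"
      using fin card_Int_Diff[of ?s F] card_Int_Diff[of ?t F] by auto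
    have "card (?s \<inter> F) + card (?t \<inter> F) = card ((?s \<inter> F) \<union> (?t \<inter> F))"
      using fin \<open>?s \<inter> ?t = {}\<close> by (intro card_Un_disjoint[symmetric]) auto
    also have "\<dots> \<le> card F" using fin by (intro card_mono) auto
    finally have "real (card (?s \<inter> F) + card (?t \<inter> F)) \<le> card F" by simp
    moreover have "real (card (?s - F)) \<le> card F / 3" "real (card (?t - F)) \<le> card F / 3"
      using F by (auto simp: almost_invariant_def)
    ultimately show False using s t pos by linarith
  qed
  then show ?thesis by blast
qed

text \<open>Left translation is injective and commutes with right multiplication, so it preserves
  every defect exactly. No uniformity in \<open>i\<close> is involved, which lets \<open>t i\<close>
  be chosen later in terms of \<open>F i\<close>.\<close>

lemma right_Folner_net_left_translate:
  fixes F :: "'i \<Rightarrow> 's::cancellative_monoid set"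
  assumes "right_Folner_net I r F"
  shows "right_Folner_net I r (\<lambda>i. (*) (t i) ` F i)"
proof -
  have "card ((\<lambda>x. x * s) ` (*) u ` A - (*) u ` A) = card ((\<lambda>x. x * s) ` A - A)"
    for s u :: 's and A
  proof -
    have "(\<lambda>x. x * s) ` (*) u ` A - (*) u ` A = (*) u ` ((\<lambda>x. x * s) ` A - A)"
      by (auto simp: image_image mult.assoc dest: mult_left_cancellative)
    then show ?thesis by simp
  qed
  then show ?thesis using assms unfolding right_Folner_net_def by simp
qed


section \<open>The Ornstein--Weiss limit\<close>

text \<open>\<open>C\<close> is a largest set of centres whose translates of \<open>A\<close> lie in
  \<open>F\<close> and overlap little. If they covered less than \<open>\<epsilon> / 2\<close> of
  \<open>F\<close>, averaging would produce one more translate that could be added.\<close>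

lemma ex_quasi_tiling:
  fixes A F :: "'s::cancellative_monoid set"
  assumes A: "finite A" "A \<noteq> {}" and \<epsilon>: "0 < \<epsilon>" "\<epsilon> < 1"
    and F: "almost_invariant A (1 / (2 * real (card A))) F"
  obtains C where "finite C" "(\<Union>x\<in>C. (*) x ` A) \<subseteq> F"
    "(1 - \<epsilon>) * (real (card C) * real (card A)) \<le> real (card (\<Union>x\<in>C. (*) x ` A))"
    "\<epsilon> / 2 * real (card F) \<le> real (card (\<Union>x\<in>C. (*) x ` A))"
proof -
  let ?U = "\<lambda>C. \<Union>x\<in>C. (*) x ` A"
  have finF: "finite F" and cF: "card F > 0" and cA: "card A > 0"
    using F A by (auto simp: almost_invariant_def card_gt_0_iff)
  \<comment> \<open>The admissible centres. Summing the defect \<open>1 / (2 * card A)\<close> over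
    \<open>a \<in> A\<close> shows that they make up at least half of \<open>F\<close>.\<close>
  define G where "G = {x \<in> F. (*) x ` A \<subseteq> F}"
  have finG: "finite G" using finF by (simp add: G_def)
  have "real (card (F - G)) \<le> (\<Sum>a\<in>A. real (card ((\<lambda>x. x * a) ` F - F)))"
  proof -
    have "F - G \<subseteq> (\<Union>a\<in>A. {x \<in> F. x * a \<notin> F})" by (auto simp: G_def)
    then have "card (F - G) \<le> card (\<Union>a\<in>A. {x \<in> F. x * a \<notin> F})"
      using finF A by (intro card_mono) auto
    also have "\<dots> \<le> (\<Sum>a\<in>A. card {x \<in> F. x * a \<notin> F})" by (rule card_UN_le[OF A(1)])
    also have "\<dots> = (\<Sum>a\<in>A. card ((\<lambda>x. x * a) ` F - F))"
    proof (rule sum.cong[OF refl])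
      fix a
      have "(\<lambda>x. x * a) ` F - F = (\<lambda>x. x * a) ` {x \<in> F. x * a \<notin> F}" by auto
      then show "card {x \<in> F. x * a \<notin> F} = card ((\<lambda>x. x * a) ` F - F)" by simp
    qed
    finally have "real (card (F - G)) \<le> real (\<Sum>a\<in>A. card ((\<lambda>x. x * a) ` F - F))"
      by (simp only: of_nat_le_iff)
    then show ?thesis by simp
  qed
  also have "\<dots> \<le> (\<Sum>a\<in>A. 1 / (2 * real (card A)) * real (card F))"
    using F by (intro sum_mono) (auto simp: almost_invariant_def)
  also have "\<dots> = card F / 2" using cA by simp
  finally have "real (card (F - G)) \<le> card F / 2" .
  moreover have "card F = card G + card (F - G)"
    using finG finF card_Diff_subset[of G F] card_mono[of F G] by (simp add: G_def subset_iff)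
  ultimately have cG: "real (card G) \<ge> card F / 2" by linarith
  define Q where "Q C \<longleftrightarrow> C \<subseteq> G \<and> (1 - \<epsilon>) * (real (card C) * real (card A)) \<le> real (card (?U C))" for C
  have "Q {}" by (simp add: Q_def)
  moreover have "\<forall>C. Q C \<longrightarrow> card C < Suc (card F)"
    using finF unfolding Q_def G_def by (auto simp: less_Suc_eq_le intro!: card_mono)
  ultimately obtain C where QC: "Q C" and maxC: "\<And>D. Q D \<Longrightarrow> card D \<le> card C"
    using ex_has_greatest_nat[of Q "{}" card "Suc (card F)"] by (metis less_imp_le)
  have CG: "C \<subseteq> G" and finC: "finite C" using QC finG by (auto simp: Q_def intro: finite_subset)
  have UF: "?U C \<subseteq> F" using CG by (auto simp: G_def)
  then have finU: "finite (?U C)" using finF finite_subset by blast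
  have "\<epsilon> / 2 * real (card F) \<le> real (card (?U C))"
  proof (rule ccontr)
    assume "\<not> ?thesis"
    then have small: "real (card (?U C)) < \<epsilon> / 2 * real (card F)" by simp
    \<comment> \<open>Double counting: on average over \<open>x \<in> G\<close>, the translate \<open>x A\<close> meets \<open>C A\<close> in few points.\<close>
    have "\<exists>x\<in>G. real (card ((*) x ` A \<inter> ?U C)) < \<epsilon> * card A"
    proof (rule ccontr)
      assume "\<not> ?thesis"
      then have "(\<Sum>x\<in>G. \<epsilon> * card A) \<le> (\<Sum>x\<in>G. real (card ((*) x ` A \<inter> ?U C)))"
        by (intro sum_mono) (auto simp: not_less)
      also have "\<dots> = (\<Sum>x\<in>G. real (card {a \<in> A. x * a \<in> ?U C}))"
      proof (rule sum.cong[OF refl])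
        fix x
        have "(*) x ` A \<inter> ?U C = (*) x ` {a \<in> A. x * a \<in> ?U C}" by auto
        then show "real (card ((*) x ` A \<inter> ?U C)) = real (card {a \<in> A. x * a \<in> ?U C})"
          by (simp only: card_mult_left)
      qed
      also have "\<dots> = real (\<Sum>x\<in>G. card {a \<in> A. x * a \<in> ?U C})" by simp
      also have "(\<Sum>x\<in>G. card {a \<in> A. x * a \<in> ?U C}) = (\<Sum>a\<in>A. card {x \<in> G. x * a \<in> ?U C})"
        using sum_multicount_gen[OF finG A(1), of "\<lambda>x a. x * a \<in> ?U C"
            "\<lambda>a. card {x \<in> G. x * a \<in> ?U C}"] by simp
      \<comment> \<open>For fixed \<open>a\<close>, right cancellation embeds the counted
        \<open>x\<close> into the covered set by sending \<open>x\<close> to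
        \<open>x * a\<close>.\<close>
      also have "\<dots> \<le> (\<Sum>a\<in>A. card (?U C))"
      proof (rule sum_mono)
        fix a
        have "card {x \<in> G. x * a \<in> ?U C} = card ((\<lambda>x. x * a) ` {x \<in> G. x * a \<in> ?U C})" by simp
        also have "\<dots> \<le> card (?U C)" using finU by (intro card_mono) auto
        finally show "card {x \<in> G. x * a \<in> ?U C} \<le> card (?U C)" .
      qed
      finally have "real (card G) * (\<epsilon> * card A) \<le> real (card A) * card (?U C)" by simp
      then have "real (card G) * \<epsilon> \<le> card (?U C)" using cA by (simp add: field_simps)
      moreover have "card F / 2 * \<epsilon> \<le> real (card G) * \<epsilon>" using cG \<epsilon> by (intro mult_right_mono) auto
      ultimately show False using small by (simp add: field_simps)
    qed
    then obtain x where x: "x \<in> G" "real (card ((*) x ` A \<inter> ?U C)) < \<epsilon> * card A" by blast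
    \<comment> \<open>The new centre must be genuinely new, so that inserting it contradicts the
      maximality of \<open>card C\<close>.\<close>
    have "x \<notin> C"
    proof
      assume "x \<in> C"
      then have "(*) x ` A \<inter> ?U C = (*) x ` A" by auto
      then have "real (card A) < \<epsilon> * card A" using x(2) by simp
      then show False using \<epsilon> cA by simp
    qed
    have "?U (insert x C) = ?U C \<union> ((*) x ` A - ?U C)" by auto
    then have "card (?U (insert x C)) = card (?U C) + card ((*) x ` A - ?U C)"
      using finU A by (simp only:) (intro card_Un_disjoint; auto)
    moreover have "card A = card ((*) x ` A \<inter> ?U C) + card ((*) x ` A - ?U C)"
      using card_Int_Diff[of "(*) x ` A" "?U C"] A by simp
    ultimately have "real (card (?U (insert x C))) \<ge> card (?U C) + (1 - \<epsilon>) * card A"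
      using x(2) by (simp add: algebra_simps)
    then have "Q (insert x C)"
      using QC x(1) \<open>x \<notin> C\<close> finC unfolding Q_def by (simp add: algebra_simps)
    then show False using maxC[of "insert x C"] \<open>x \<notin> C\<close> finC by simp
  qed
  then show ?thesis using that[OF finC UF] QC by (simp add: Q_def)
qed

text \<open>If \<open>r\<close> lies in the remainder and \<open>r * s\<close> does not, then
  \<open>r * s\<close> either leaves \<open>F\<close> or equals some \<open>x * a\<close> in a tile.
  In the second case \<open>a\<close> is not in \<open>A s\<close>, since cancelling
  \<open>s\<close> would put \<open>r\<close> itself in the tile. So the defects of \<open>F\<close>
  and of the tiles bound that of the remainder.\<close>

lemma almost_invariant_Diff_tiles:
  fixes A F :: "'s::cancellative_monoid set"
  assumes A: "almost_invariant K \<alpha> A" and F: "almost_invariant K \<beta> F" and C: "finite C"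
    and UF: "(\<Union>x\<in>C. (*) x ` A) \<subseteq> F" and ne: "F - (\<Union>x\<in>C. (*) x ` A) \<noteq> {}"
    and bound: "\<beta> * real (card F) + \<alpha> * (real (card C) * real (card A))
        \<le> \<eta> * real (card (F - (\<Union>x\<in>C. (*) x ` A)))"
  shows "almost_invariant K \<eta> (F - (\<Union>x\<in>C. (*) x ` A))"
  unfolding almost_invariant_def
proof (intro conjI ballI)
  let ?U = "\<Union>x\<in>C. (*) x ` A"
  have finF: "finite F" and finA: "finite A" using A F by (auto simp: almost_invariant_def)
  then show "finite (F - ?U)" by simp
  show "F - ?U \<noteq> {}" by (rule ne)
  fix s assume s: "s \<in> K"
  let ?R = "F - ?U"
  have "(\<lambda>x. x * s) ` ?R - ?R \<subseteq> ((\<lambda>x. x * s) ` F - F) \<union> (\<Union>x\<in>C. (*) x ` (A - (\<lambda>y. y * s) ` A))"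
  proof
    fix y assume y: "y \<in> (\<lambda>x. x * s) ` ?R - ?R"
    then obtain r where r: "y = r * s" "r \<in> F" "r \<notin> ?U" by auto
    show "y \<in> ((\<lambda>x. x * s) ` F - F) \<union> (\<Union>x\<in>C. (*) x ` (A - (\<lambda>y. y * s) ` A))"
    proof (cases "y \<in> F")
      case True
      then obtain x a where xa: "x \<in> C" "a \<in> A" "y = x * a" using y by auto
      have "a \<notin> (\<lambda>y. y * s) ` A"
      proof
        assume "a \<in> (\<lambda>y. y * s) ` A"
        then obtain b where b: "b \<in> A" "a = b * s" by auto
        then have "r * s = x * b * s" using r xa by (simp add: mult.assoc)
        then have "r = x * b" by (rule mult_right_cancellative)
        then show False using r(3) xa(1) b(1) by auto
      qed
      then show ?thesis using xa by blast
    next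
      case False
      then show ?thesis using r by auto
    qed
  qed
  then have "card ((\<lambda>x. x * s) ` ?R - ?R)
      \<le> card (((\<lambda>x. x * s) ` F - F) \<union> (\<Union>x\<in>C. (*) x ` (A - (\<lambda>y. y * s) ` A)))"
    using finF finA C by (intro card_mono) auto
  also have "\<dots> \<le> card ((\<lambda>x. x * s) ` F - F) + card (\<Union>x\<in>C. (*) x ` (A - (\<lambda>y. y * s) ` A))"
    by (rule card_Un_le)
  also have "card (\<Union>x\<in>C. (*) x ` (A - (\<lambda>y. y * s) ` A))
      \<le> (\<Sum>x\<in>C. card ((*) x ` (A - (\<lambda>y. y * s) ` A)))" by (rule card_UN_le[OF C])
  also have "\<dots> = card C * card (A - (\<lambda>y. y * s) ` A)" by simp
  \<comment> \<open>\<open>A\<close> and \<open>A s\<close> have equal cardinality, hence so do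
    their two differences.\<close>
  also have "card (A - (\<lambda>y. y * s) ` A) = card ((\<lambda>y. y * s) ` A - A)"
    using card_Int_Diff[of A "(\<lambda>y. y * s) ` A"] card_Int_Diff[of "(\<lambda>y. y * s) ` A" A] finA
    by (simp add: Int_commute)
  finally have "real (card ((\<lambda>x. x * s) ` ?R - ?R))
      \<le> real (card ((\<lambda>x. x * s) ` F - F) + card C * card ((\<lambda>y. y * s) ` A - A))"
    by (simp only: of_nat_le_iff add_left_mono)
  also have "\<dots> \<le> \<beta> * real (card F) + real (card C) * (\<alpha> * real (card A))"
    using A F s by (auto simp: almost_invariant_def intro!: add_mono mult_left_mono)
  also have "\<dots> \<le> \<eta> * real (card ?R)" using bound by (simp add: algebra_simps)
  finally show "real (card ((\<lambda>x. x * s) ` ?R - ?R)) \<le> \<eta> * real (card ?R)" .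
qed

text \<open>The properties of cover entropy on which the limit argument rests.
  \<open>left_mult\<close> is an inequality because \<rho>\<open>t\<close> may fail to be
  surjective: covering its image can take fewer sets than covering the whole space.\<close>

locale subadditive_set_function =
  fixes f :: "'s::cancellative_monoid set \<Rightarrow> real"
  assumes empty: "f {} = 0"
    and nonneg: "finite A \<Longrightarrow> 0 \<le> f A"
    and subadd: "finite A \<Longrightarrow> finite B \<Longrightarrow> f (A \<union> B) \<le> f A + f B"
    and left_mult: "finite A \<Longrightarrow> f ((*) t ` A) \<le> f A"
begin

lemma le_UN: "finite C \<Longrightarrow> (\<And>x. x \<in> C \<Longrightarrow> finite (B x)) \<Longrightarrow> f (\<Union>x\<in>C. B x) \<le> (\<Sum>x\<in>C. f (B x))"
proof (induction C rule: finite_induct)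
  case (insert x C)
  then show ?case using subadd[of "B x" "\<Union>x\<in>C. B x"] by auto
qed (simp add: empty)

text \<open>Split \<open>A\<close> into singletons, each a left translate of \<open>{1}\<close>.
  This bounds all densities by \<open>f {1}\<close>.\<close>

lemma le_card: "finite A \<Longrightarrow> f A \<le> f {1} * real (card A)"
proof -
  assume A: "finite A"
  have "f (\<Union>x\<in>A. {x}) \<le> (\<Sum>x\<in>A. f {x})" using A by (intro le_UN) auto
  also have "\<dots> \<le> (\<Sum>x\<in>A. f {1})" using left_mult[of "{1}"] by (intro sum_mono) auto
  finally show ?thesis by (simp add: mult.commute)
qed

text \<open>\<open>L\<close> plays the role of the limit superior of \<open>f F / card F\<close>. If some very invariant \<open>A\<close> had
  density below \<open>L\<close>, then filling a fixed proportion of a nearly extremal \<open>F\<close> with almost disjoint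
  translates of \<open>A\<close> leaves a set which is still almost invariant, hence of density at most about
  \<open>L\<close>; together this makes the density of \<open>F\<close> too small.\<close>

lemma density_lower_bound:
  assumes \<delta>: "\<delta> > 0"
    and upper: "\<And>e. e > 0 \<Longrightarrow> \<exists>K \<eta>. finite K \<and> \<eta> > 0 \<and>
      (\<forall>F. almost_invariant K \<eta> F \<longrightarrow> f F \<le> (L + e) * real (card F))"
    and extremal: "\<And>K \<eta> e. finite K \<Longrightarrow> \<eta> > 0 \<Longrightarrow> e > 0 \<Longrightarrow>
      \<exists>F. almost_invariant K \<eta> F \<and> (L - e) * real (card F) < f F"
  shows "\<exists>K \<eta>. finite K \<and> \<eta> > 0 \<and> (\<forall>A. almost_invariant K \<eta> A \<longrightarrow> (L - \<delta>) * real (card A) \<le> f A)"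
proof (rule ccontr)
  assume "\<not> ?thesis"
  then have low: "\<exists>A. almost_invariant K \<eta> A \<and> f A < (L - \<delta>) * real (card A)"
    if "finite K" "\<eta> > 0" for K \<eta> using that by (meson not_less)
  \<comment> \<open>\<open>M\<close> dominates both \<open>L\<close> and \<open>f {1}\<close>, so
    the choice of \<open>\<epsilon>\<close> keeps the overlap loss \<open>L * \<epsilon>\<close> and
    the cost of a remainder below \<open>\<epsilon> * card F\<close> within \<delta>/8.\<close>
  define M where "M = f {1} + \<bar>L\<bar> + 1"
  have M: "M \<ge> 1" "L \<le> M" "f {1} \<le> M" using nonneg[of "{1}"] by (auto simp: M_def)
  define \<epsilon> where "\<epsilon> = min (1/2) (\<delta> / (8 * M))"
  have \<epsilon>: "0 < \<epsilon>" "\<epsilon> \<le> 1/2" "M * \<epsilon> \<le> \<delta> / 8"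
    using \<delta> M by (auto simp: \<epsilon>_def min_def field_simps)
  \<comment> \<open>The tiles save at least \<open>\<epsilon> * \<delta> / 4\<close> per point of
    \<open>F\<close>; the two errors \<open>e\<close> together cost only
    \<open>\<epsilon> * \<delta> / 8\<close>.\<close>
  define e where "e = \<epsilon> * \<delta> / 16"
  have e: "e > 0" "e \<le> \<delta> / 16" using \<epsilon> \<delta> by (auto simp: e_def field_simps)
  obtain K \<eta> where K: "finite K" "\<eta> > 0"
    and up: "\<And>F. almost_invariant K \<eta> F \<Longrightarrow> f F \<le> (L + e) * real (card F)"
    using upper[OF e(1)] by blast
  \<comment> \<open>In the case of a large remainder its total defect is at most
    \<open>3 * \<alpha> * card F\<close>, which this choice keeps below
    \<open>\<eta> * \<epsilon> * card F\<close>.\<close>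
  define \<alpha> where "\<alpha> = \<eta> * \<epsilon> / 4"
  have \<alpha>: "\<alpha> > 0" using K \<epsilon> by (simp add: \<alpha>_def)
  obtain A where A: "almost_invariant K \<alpha> A" "f A < (L - \<delta>) * real (card A)"
    using low[OF K(1) \<alpha>] by blast
  have finA: "finite A" "A \<noteq> {}" and cA: "real (card A) > 0"
    using A by (auto simp: almost_invariant_def card_gt_0_iff)
  \<comment> \<open>Invariance under \<open>A\<close> permits the quasi-tiling of \<open>F\<close>;
    invariance under \<open>K\<close> is inherited by what the tiles leave over.\<close>
  obtain F where F: "almost_invariant (K \<union> A) (min \<alpha> (1 / (2 * real (card A)))) F"
      "(L - e) * real (card F) < f F"
    using extremal[of "K \<union> A" "min \<alpha> (1 / (2 * real (card A)))" e] K finA \<alpha> cA e by auto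
  have FK: "almost_invariant K \<alpha> F" and FA: "almost_invariant A (1 / (2 * real (card A))) F"
    using almost_invariant_mono[OF F(1)] by auto
  have finF: "finite F" and cF: "real (card F) > 0"
    using FK by (auto simp: almost_invariant_def card_gt_0_iff)
  obtain C where C: "finite C" "(\<Union>x\<in>C. (*) x ` A) \<subseteq> F"
    "(1 - \<epsilon>) * (real (card C) * real (card A)) \<le> real (card (\<Union>x\<in>C. (*) x ` A))"
    "\<epsilon> / 2 * real (card F) \<le> real (card (\<Union>x\<in>C. (*) x ` A))"
    using ex_quasi_tiling[OF finA _ _ FA, of \<epsilon>] \<epsilon> by auto
  let ?U = "\<Union>x\<in>C. (*) x ` A"
  \<comment> \<open>\<open>u\<close> counts the covered points once, \<open>n\<close> counts them
    with multiplicity.\<close>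
  define u where "u = real (card ?U)"
  define n where "n = real (card C) * real (card A)"
  have cR: "real (card (F - ?U)) = real (card F) - u"
    using C(2) finF by (simp add: u_def card_Diff_subset card_mono finite_subset of_nat_diff)
  have uF: "u \<le> card F" using C(2) finF by (simp add: u_def card_mono)
  have u: "(1 - \<epsilon>) * n \<le> u" "\<epsilon> / 2 * card F \<le> u" using C by (auto simp: u_def n_def)
  have n0: "n \<ge> 0" by (simp add: n_def)
  \<comment> \<open>Positivity comes from \<open>0 \<le> f A\<close>; it licenses multiplying the
    bounds on \<open>u\<close> by \<open>L - \<delta> / 2\<close>.\<close>
  have c0: "L - \<delta> > 0" using nonneg[OF finA(1)] A(2) cA by (smt (verit) mult_nonpos_nonneg)
  have fU: "f ?U \<le> (L - \<delta> / 2) * u"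
  proof -
    have "f ?U \<le> (\<Sum>x\<in>C. f ((*) x ` A))" using C finA by (intro le_UN) auto
    also have "\<dots> \<le> (\<Sum>x\<in>C. f A)" using left_mult finA by (intro sum_mono) auto
    also have "\<dots> = real (card C) * f A" by simp
    also have "\<dots> \<le> real (card C) * ((L - \<delta>) * real (card A))"
      using A(2) by (intro mult_left_mono) auto
    also have "\<dots> = (L - \<delta>) * n" by (simp add: n_def)
    also have "\<dots> \<le> (L - \<delta> / 2) * ((1 - \<epsilon>) * n)"
    proof -
      have "L * \<epsilon> \<le> M * \<epsilon>" using M \<epsilon> by (intro mult_right_mono) auto
      moreover have "\<delta> * \<epsilon> \<ge> 0" using \<delta> \<epsilon> by simp
      moreover have "(L - \<delta> / 2) * (1 - \<epsilon>) = L - \<delta> / 2 - L * \<epsilon> + \<delta> * \<epsilon> / 2"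
        by (simp add: field_simps)
      ultimately have "L - \<delta> \<le> (L - \<delta> / 2) * (1 - \<epsilon>)"
        using \<epsilon>(3) \<delta> by linarith
      from mult_right_mono[OF this n0] show ?thesis by (simp add: mult.assoc)
    qed
    also have "\<dots> \<le> (L - \<delta> / 2) * u" using u(1) c0 \<delta> by (intro mult_left_mono) auto
    finally show ?thesis .
  qed
  have "?U \<union> (F - ?U) = F" using C(2) by blast
  then have "f F \<le> f ?U + f (F - ?U)"
    using subadd[of ?U "F - ?U"] finite_subset[OF C(2) finF] finF by simp
  then have main: "(L - e) * card F < (L - \<delta> / 2) * u + f (F - ?U)" using F(2) fU by linarith
  show False
  \<comment> \<open>A remainder of proportion at least \<open>\<epsilon>\<close> is still almost
    invariant, so \<open>up\<close> applies to it. A smaller one may fail to be so, but then the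
    linear bound \<open>le_card\<close> is good enough.\<close>
  proof (cases "\<epsilon> * card F \<le> card F - u")
    case True
    have "n \<le> 2 * card F"
    proof -
      have "1/2 * n \<le> (1 - \<epsilon>) * n" using \<epsilon> n0 by (intro mult_right_mono) auto
      then show ?thesis using u uF by linarith
    qed
    then have "\<alpha> * n \<le> \<alpha> * (2 * card F)" using \<alpha> by (intro mult_left_mono) auto
    then have "\<alpha> * card F + \<alpha> * n \<le> 3 * \<alpha> * card F" by simp
    also have "\<dots> \<le> \<eta> * (\<epsilon> * card F)" using K \<epsilon> by (simp add: \<alpha>_def field_simps)
    also have "\<dots> \<le> \<eta> * (card F - u)" using True K by (intro mult_left_mono) auto
    finally have "\<alpha> * card F + \<alpha> * n \<le> \<eta> * real (card (F - ?U))" by (simp add: cR)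
    moreover have "F - ?U \<noteq> {}"
    proof
      assume R: "F - ?U = {}"
      have "real (card F) - u = 0" using cR unfolding R by simp
      then show False using True \<epsilon>(1) cF by (simp add: mult_le_0_iff)
    qed
    ultimately have "almost_invariant K \<eta> (F - ?U)"
      using almost_invariant_Diff_tiles[OF A(1) FK C(1,2)] by (simp add: n_def)
    from up[OF this] have "f (F - ?U) \<le> (L + e) * (card F - u)" by (simp add: cR)
    then have "(L - e) * card F < (L - \<delta> / 2) * u + (L + e) * (card F - u)"
      using main by linarith
    then have "\<delta> / 2 * u + e * u < 2 * e * card F" by (simp add: algebra_simps)
    moreover have "\<delta> / 2 * (\<epsilon> / 2 * card F) \<le> \<delta> / 2 * u" using u \<delta> by (intro mult_left_mono) auto
    moreover have "e * u \<ge> 0" using e by (simp add: u_def)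
    ultimately have "\<delta> / 2 * (\<epsilon> / 2 * card F) < 2 * e * card F" by linarith
    then show False using \<delta> \<epsilon> cF by (simp add: e_def field_simps)
  next
    case False
    have "f (F - ?U) \<le> f {1} * (card F - u)" using le_card[of "F - ?U"] finF by (simp add: cR)
    also have "\<dots> \<le> M * (\<epsilon> * card F)" using False M uF by (intro mult_mono) auto
    also have "\<dots> \<le> \<delta> / 8 * card F" using mult_right_mono[OF \<epsilon>(3), of "card F"] by simp
    finally have "f (F - ?U) \<le> \<delta> / 8 * card F" .
    moreover have "(L - \<delta> / 2) * u \<le> (L - \<delta> / 2) * card F"
      using uF c0 \<delta> by (intro mult_left_mono) auto
    ultimately have "(L - e) * card F < (L - \<delta> / 2) * card F + \<delta> / 8 * card F"
      using main by linarith
    then have "\<delta> * 3 / 8 * card F < e * card F" by (simp add: algebra_simps)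
    moreover have "e * card F \<le> \<delta> / 16 * card F" using e by (intro mult_right_mono) auto
    moreover have "\<delta> * card F > 0" using \<delta> cF by simp
    ultimately show False by (simp add: algebra_simps)
  qed
qed

text \<open>\<open>T\<close> collects the upper bounds for the density that hold on all sufficiently
  invariant sets, and its infimum \<open>L\<close> is the limit. Anything below \<open>L\<close> is
  not in \<open>T\<close>, which supplies the extremal sets for \<open>density_lower_bound\<close>.
  Both estimates depend only on invariance, so \<open>L\<close> serves every net.\<close>

theorem ex_Folner_limit:
  assumes amen: "right_amenable TYPE('s)"
  shows "\<exists>l. is_Folner_limit (\<lambda>F. f F / real (card F)) l"
proof -
  define T where "T = {c. \<exists>K \<eta>. finite K \<and> \<eta> > 0 \<and>
      (\<forall>F. almost_invariant K \<eta> F \<longrightarrow> f F \<le> c * real (card F))}"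
  define L where "L = Inf T"
  have "f {1} \<in> T" unfolding T_def
    by (auto intro!: exI[of _ "{}"] exI[of _ 1] le_card simp: almost_invariant_def)
  then have "T \<noteq> {}" by blast
  \<comment> \<open>Amenability provides an almost invariant set, so membership in \<open>T\<close>
    is never vacuous and forces \<open>0 \<le> c\<close>.\<close>
  have "bdd_below T"
  proof (rule bdd_belowI)
    fix c assume "c \<in> T"
    then obtain K \<eta> where K: "finite K" "\<eta> > 0" "\<And>F. almost_invariant K \<eta> F \<Longrightarrow> f F \<le> c * real (card F)"
      unfolding T_def by blast
    obtain F where F: "almost_invariant K \<eta> F" using ex_almost_invariant[OF amen K(1,2)] .
    then have "finite F" "real (card F) > 0" by (auto simp: almost_invariant_def card_gt_0_iff)
    moreover have "0 \<le> c * real (card F)" using K(3)[OF F] nonneg[OF \<open>finite F\<close>] by linarith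
    ultimately show "0 \<le> c" by (meson mult_neg_pos not_less)
  qed
  have upper: "\<exists>K \<eta>. finite K \<and> \<eta> > 0 \<and>
      (\<forall>F. almost_invariant K \<eta> F \<longrightarrow> f F \<le> (L + e) * real (card F))" if "e > 0" for e
  proof -
    have "Inf T < L + e" using that by (simp add: L_def)
    then obtain c where c: "c \<in> T" "c < L + e" using cInf_lessD[OF \<open>T \<noteq> {}\<close>] by blast
    then have "c * real m \<le> (L + e) * real m" for m by (intro mult_right_mono) auto
    moreover obtain K \<eta> where "finite K" "\<eta> > 0" "\<And>F. almost_invariant K \<eta> F \<Longrightarrow> f F \<le> c * real (card F)"
      using c(1) unfolding T_def by blast
    ultimately show ?thesis by (meson order_trans)
  qed
  have extremal: "\<exists>F. almost_invariant K \<eta> F \<and> (L - e) * real (card F) < f F"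
    if "finite K" "\<eta> > 0" "e > 0" for K \<eta> e
  proof (rule ccontr)
    assume "\<not> ?thesis"
    then have "L - e \<in> T" using that unfolding T_def by (auto simp: not_less)
    then have "L \<le> L - e" unfolding L_def by (rule cInf_lower) fact
    then show False using that by simp
  qed
  have "((\<lambda>i. f (F i) / real (card (F i))) \<longlongrightarrow> L) (net_filter I r)"
    if F: "right_Folner_net I r F" for I :: "('s set \<times> nat) set" and r and F :: "_ \<Rightarrow> 's set"
  proof (rule tendstoI)
    fix e :: real assume "e > 0"
    then have e: "e / 2 > 0" by simp
    obtain K \<eta> where K: "finite K" "\<eta> > 0"
      "\<And>F. almost_invariant K \<eta> F \<Longrightarrow> f F \<le> (L + e / 2) * real (card F)"
      using upper[OF e] by blast
    obtain K' \<eta>' where K': "finite K'" "\<eta>' > 0"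
      "\<And>F. almost_invariant K' \<eta>' F \<Longrightarrow> (L - e / 2) * real (card F) \<le> f F"
      using density_lower_bound[OF e upper extremal] by blast
    show "eventually (\<lambda>i. dist (f (F i) / real (card (F i))) L < e) (net_filter I r)"
      using eventually_almost_invariant[OF F K(1,2)] eventually_almost_invariant[OF F K'(1,2)]
    proof eventually_elim
      case (elim i)
      then have "real (card (F i)) > 0" by (auto simp: almost_invariant_def card_gt_0_iff)
      then have "f (F i) / card (F i) \<le> L + e / 2" "L - e / 2 \<le> f (F i) / card (F i)"
        using K(3) K'(3) elim by (simp_all add: divide_le_eq le_divide_eq)
      then show ?case using \<open>e > 0\<close> by (auto simp: dist_real_def abs_less_iff)
    qed
  qed
  then show ?thesis unfolding is_Folner_limit_def by blast
qed

end

section \<open>The cover entropy of an action\<close>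

lemma action_coverI:
  assumes "F \<noteq> {}" "\<forall>s\<in>F. A s \<in> \<U>"
  shows "{x \<in> topspace X. \<forall>s\<in>F. \<rho> s x \<in> A s} \<in> action_cover X \<rho> \<U> F"
proof -
  have "{x \<in> topspace X. \<forall>s\<in>F. \<rho> s x \<in> A s} = (\<Inter>s\<in>F. {x \<in> topspace X. \<rho> s x \<in> A s})"
    using assms by auto
  then show ?thesis using assms unfolding action_cover_def cover_Join_def preimage_cover_def
    by (intro CollectI exI[of _ "\<lambda>s. {x \<in> topspace X. \<rho> s x \<in> A s}"]) auto
qed

lemma action_coverE:
  assumes W: "W \<in> action_cover X \<rho> \<U> F" and F: "F \<noteq> {}"
  obtains A where "W = {x \<in> topspace X. \<forall>s\<in>F. \<rho> s x \<in> A s}" "\<forall>s\<in>F. A s \<in> \<U>"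
proof -
  obtain B where B: "W = (\<Inter>s\<in>F. B s)" "\<forall>s\<in>F. B s \<in> preimage_cover X (\<rho> s) \<U>"
    using W unfolding action_cover_def cover_Join_def by blast
  then have "\<forall>s\<in>F. \<exists>U. U \<in> \<U> \<and> B s = {x \<in> topspace X. \<rho> s x \<in> U}"
    unfolding preimage_cover_def by blast
  from bchoice[OF this] obtain A
    where A: "\<forall>s\<in>F. A s \<in> \<U> \<and> B s = {x \<in> topspace X. \<rho> s x \<in> A s}" ..
  show ?thesis
  proof
    show "W = {x \<in> topspace X. \<forall>s\<in>F. \<rho> s x \<in> A s}" using A B(1) F by auto
  qed (use A in blast)
qed

text \<open>Members of a joined cover do not remember the choices that produced them. Choice
  functions do, and can be reindexed, glued and restricted; leaving \<open>Y\<close> free allows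
  covers of the core or of the range of a \<rho>\<open>t\<close>.\<close>

definition itineraries_cover ::
    "('s \<Rightarrow> 'k \<Rightarrow> 'k) \<Rightarrow> 'k set set \<Rightarrow> 's set \<Rightarrow> 'k set \<Rightarrow> ('s \<Rightarrow> 'k set) set \<Rightarrow> bool" where
  "itineraries_cover \<rho> \<U> F Y \<A> \<longleftrightarrow> finite \<A> \<and> (\<forall>A\<in>\<A>. \<forall>s\<in>F. A s \<in> \<U>) \<and>
     (\<forall>x\<in>Y. \<exists>A\<in>\<A>. \<forall>s\<in>F. \<rho> s x \<in> A s)"

lemma cover_number_le_itineraries:
  assumes F: "F \<noteq> {}" and \<A>: "itineraries_cover \<rho> \<U> F (topspace X) \<A>"
  shows "cover_number X (action_cover X \<rho> \<U> F) \<le> card \<A>"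
proof -
  let ?c = "\<lambda>A. {x \<in> topspace X. \<forall>s\<in>F. \<rho> s x \<in> A s}"
  have "?c ` \<A> \<subseteq> action_cover X \<rho> \<U> F"
    using \<A> unfolding itineraries_cover_def by (intro image_subsetI action_coverI[OF F]) blast
  moreover have "finite (?c ` \<A>)" "\<Union> (?c ` \<A>) = topspace X"
    using \<A> unfolding itineraries_cover_def by auto
  ultimately have "cover_number X (action_cover X \<rho> \<U> F) \<le> card (?c ` \<A>)"
    unfolding cover_number_def by (intro Least_le exI[of _ "?c ` \<A>"]) auto
  also have "\<dots> \<le> card \<A>" using \<A> by (intro card_image_le) (simp add: itineraries_cover_def)
  finally show ?thesis .
qed

text \<open>Compactness yields a finite subcover, so the \<open>LEAST\<close> in
  \<open>cover_number\<close> is attained. Choosing one itinerary per member of a minimal subcover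
  is injective, as an itinerary determines its set; hence the equality of cardinalities.\<close>

lemma ex_itineraries_cover:
  assumes X: "compact_space X" and \<rho>: "\<And>s. continuous_map X X (\<rho> s)" and \<U>: "open_cover X \<U>"
    and F: "finite F" "F \<noteq> {}"
  obtains \<A> where "itineraries_cover \<rho> \<U> F (topspace X) \<A>"
    "card \<A> = cover_number X (action_cover X \<rho> \<U> F)"
proof -
  let ?c = "\<lambda>A. {x \<in> topspace X. \<forall>s\<in>F. \<rho> s x \<in> A s}"
  have "openin X W" if W: "W \<in> action_cover X \<rho> \<U> F" for W
  proof -
    obtain A where A: "W = ?c A" "\<forall>s\<in>F. A s \<in> \<U>"
      using action_coverE[OF W F(2)] .
    have "W = (\<Inter>s\<in>F. {x \<in> topspace X. \<rho> s x \<in> A s})" using A F by auto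
    moreover have "openin X {x \<in> topspace X. \<rho> s x \<in> A s}" if "s \<in> F" for s
      using A(2) that \<U> by (intro openin_continuous_map_preimage[OF \<rho>]) (auto simp: open_cover_def)
    ultimately show ?thesis using F by auto
  qed
  moreover have "\<Union> (action_cover X \<rho> \<U> F) = topspace X"
  proof
    show "\<Union> (action_cover X \<rho> \<U> F) \<subseteq> topspace X" by (auto elim!: action_coverE[OF _ F(2)])
    show "topspace X \<subseteq> \<Union> (action_cover X \<rho> \<U> F)"
    proof
      fix x assume x: "x \<in> topspace X"
      then have "\<forall>s. \<exists>U\<in>\<U>. \<rho> s x \<in> U"
        using \<U> \<rho> by (auto simp: open_cover_def continuous_map_def Pi_iff)
      then obtain A where "\<forall>s. A s \<in> \<U> \<and> \<rho> s x \<in> A s" by metis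
      then have "x \<in> ?c A" "?c A \<in> action_cover X \<rho> \<U> F"
        using x action_coverI[OF F(2), of A \<U> X \<rho>] by auto
      then show "x \<in> \<Union> (action_cover X \<rho> \<U> F)" by blast
    qed
  qed
  ultimately obtain \<V> where "finite \<V>" "\<V> \<subseteq> action_cover X \<rho> \<U> F" "\<Union>\<V> = topspace X"
    using X unfolding compact_space by meson
  then have "\<exists>n. \<exists>\<V>\<subseteq>action_cover X \<rho> \<U> F. finite \<V> \<and> \<Union>\<V> = topspace X \<and> card \<V> = n" by blast
  from LeastI_ex[OF this] obtain \<V> where \<V>: "\<V> \<subseteq> action_cover X \<rho> \<U> F" "finite \<V>" "\<Union>\<V> = topspace X"
      "card \<V> = cover_number X (action_cover X \<rho> \<U> F)"
    unfolding cover_number_def by blast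
  then have "\<forall>W\<in>\<V>. \<exists>A. W = ?c A \<and> (\<forall>s\<in>F. A s \<in> \<U>)"
    by (auto elim!: action_coverE[OF _ F(2)])
  from bchoice[OF this] obtain a where a: "\<forall>W\<in>\<V>. W = ?c (a W) \<and> (\<forall>s\<in>F. a W s \<in> \<U>)" ..
  have a1: "?c (a W) = W" and a2: "\<forall>s\<in>F. a W s \<in> \<U>" if "W \<in> \<V>" for W
    using bspec[OF a that] by (blast intro: sym)+
  have "inj_on a \<V>" by (rule inj_on_inverseI[where g = ?c]) (rule a1)
  then have "card (a ` \<V>) = cover_number X (action_cover X \<rho> \<U> F)"
    using \<V>(4) by (simp add: card_image)
  moreover have "itineraries_cover \<rho> \<U> F (topspace X) (a ` \<V>)"
    unfolding itineraries_cover_def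
  proof (intro conjI)
    show "finite (a ` \<V>)" using \<V>(2) by simp
    show "\<forall>A\<in>a ` \<V>. \<forall>s\<in>F. A s \<in> \<U>" using a2 by blast
    show "\<forall>x\<in>topspace X. \<exists>A\<in>a ` \<V>. \<forall>s\<in>F. \<rho> s x \<in> A s"
    proof
      fix x assume "x \<in> topspace X"
      then obtain W where W: "W \<in> \<V>" "x \<in> W" using \<V>(3) by blast
      then have "x \<in> ?c (a W)" using a1 by simp
      then show "\<exists>A\<in>a ` \<V>. \<forall>s\<in>F. \<rho> s x \<in> A s" using W(1) by blast
    qed
  qed
  ultimately show ?thesis using that by blast
qed

text \<open>By \<open>\<rho> (t * s) x = \<rho> s (\<rho> t x)\<close>, the behaviour of
  \<open>x\<close> along \<open>t F\<close> is that of \<open>\<rho> t x\<close> along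
  \<open>F\<close>. So covering the range of \<open>\<rho> t\<close> for \<open>F\<close> is enough
  to cover all of \<open>X\<close> for \<open>t F\<close>.\<close>

lemma itineraries_cover_translate:
  fixes t :: "'s::cancellative_monoid"
  assumes \<rho>: "right_action X \<rho>" and \<A>: "itineraries_cover \<rho> \<U> F (\<rho> t ` topspace X) \<A>"
  obtains \<B> where "itineraries_cover \<rho> \<U> ((*) t ` F) (topspace X) \<B>" "card \<B> \<le> card \<A>"
proof
  \<comment> \<open>\<open>d\<close> undoes left multiplication by \<open>t\<close>, thanks to left
    cancellation, and reindexes itineraries from \<open>F\<close> to \<open>t F\<close>.\<close>
  define d where "d = inv_into UNIV ((*) t)"
  have d: "d (t * s) = s" for s
    unfolding d_def by (intro inv_into_f_f inj_mult_left) auto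
  let ?\<B> = "(\<lambda>A s. A (d s)) ` \<A>"
  show "card ?\<B> \<le> card \<A>" using \<A> by (intro card_image_le) (simp add: itineraries_cover_def)
  show "itineraries_cover \<rho> \<U> ((*) t ` F) (topspace X) ?\<B>"
    unfolding itineraries_cover_def
  proof (intro conjI ballI)
    fix x assume x: "x \<in> topspace X"
    then obtain A where A: "A \<in> \<A>" "\<forall>s\<in>F. \<rho> s (\<rho> t x) \<in> A s"
      using \<A> unfolding itineraries_cover_def by blast
    then have "\<forall>s\<in>F. \<rho> (t * s) x \<in> A (d (t * s))"
      using \<rho> x by (simp add: right_action_def d)
    then show "\<exists>B\<in>?\<B>. \<forall>s\<in>(*) t ` F. \<rho> s x \<in> B s"
      using A(1) by (intro bexI[of _ "\<lambda>s. A (d s)"]) auto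
  qed (use \<A> in \<open>auto simp: itineraries_cover_def d\<close>)
qed

text \<open>The case distinction is needed because the join over the empty set is \<open>{UNIV}\<close>.\<close>

definition cover_entropy ::
    "'k topology \<Rightarrow> ('s \<Rightarrow> 'k \<Rightarrow> 'k) \<Rightarrow> 'k set set \<Rightarrow> 's set \<Rightarrow> real" where
  "cover_entropy X \<rho> \<U> F =
     (if F = {} then 0 else ln (real (cover_number X (action_cover X \<rho> \<U> F))))"

text \<open>The two functions can differ only at the empty set, where division by
  \<open>card {} = 0\<close> makes both quotients 0.\<close>

lemma H_top_eq_cover_entropy:
  "H_top X \<rho> \<U> = (THE h. is_Folner_limit (\<lambda>F. cover_entropy X \<rho> \<U> F / real (card F)) h)"
proof -
  have "(\<lambda>F. cover_entropy X \<rho> \<U> F / real (card F)) =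
      (\<lambda>F. ln (real (cover_number X (action_cover X \<rho> \<U> F))) / real (card F))"
    by (auto simp: cover_entropy_def)
  then show ?thesis by (simp add: H_top_def)
qed

text \<open>Since \<open>ln 0 = 0\<close> in HOL, a cover number 0, as for the empty space, needs no
  separate treatment.\<close>

lemma ln_of_nat_mono: "m \<le> n \<Longrightarrow> ln (real m) \<le> ln (real n)"
  by (cases "m = 0"; cases "n = 0") (auto simp: ln_ge_zero)

lemma ln_of_nat_mult_le: "ln (real (m * n)) \<le> ln (real m) + ln (real n)"
  by (cases "m = 0"; cases "n = 0") (auto simp: ln_mult)

lemma subadditive_cover_entropy:
  fixes \<rho> :: "'s::cancellative_monoid \<Rightarrow> 'k \<Rightarrow> 'k"
  assumes X: "compact_space X" and \<rho>: "right_action X \<rho>" and \<U>: "open_cover X \<U>"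
  shows "subadditive_set_function (cover_entropy X \<rho> \<U>)"
proof
  show "cover_entropy X \<rho> \<U> {} = 0" by (simp add: cover_entropy_def)
next
  fix F :: "'s set"
  show "0 \<le> cover_entropy X \<rho> \<U> F"
    using ln_of_nat_mono[of 0] by (simp add: cover_entropy_def)
next
  have cont: "\<And>s. continuous_map X X (\<rho> s)" using \<rho> by (simp add: right_action_def)
  fix F G :: "'s set" assume fin: "finite F" "finite G"
  show "cover_entropy X \<rho> \<U> (F \<union> G) \<le> cover_entropy X \<rho> \<U> F + cover_entropy X \<rho> \<U> G"
  proof (cases "F = {} \<or> G = {}")
    case False
    then have ne: "F \<noteq> {}" "G \<noteq> {}" by auto
    obtain \<A> where \<A>: "itineraries_cover \<rho> \<U> F (topspace X) \<A>"
      "card \<A> = cover_number X (action_cover X \<rho> \<U> F)"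
      using ex_itineraries_cover[OF X cont \<U> fin(1) ne(1)] .
    obtain \<B> where \<B>: "itineraries_cover \<rho> \<U> G (topspace X) \<B>"
      "card \<B> = cover_number X (action_cover X \<rho> \<U> G)"
      using ex_itineraries_cover[OF X cont \<U> fin(2) ne(2)] .
    \<comment> \<open>Pairs of itineraries are glued; on \<open>F \<inter> G\<close> either
      component would do, and the first is taken.\<close>
    let ?c = "\<lambda>(A, B) s. if s \<in> F then A s else B s"
    have "itineraries_cover \<rho> \<U> (F \<union> G) (topspace X) (?c ` (\<A> \<times> \<B>))"
      unfolding itineraries_cover_def
    proof (intro conjI ballI)
      fix x assume "x \<in> topspace X"
      then obtain A B where AB: "A \<in> \<A>" "\<forall>s\<in>F. \<rho> s x \<in> A s" "B \<in> \<B>" "\<forall>s\<in>G. \<rho> s x \<in> B s"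
        using \<A>(1) \<B>(1) unfolding itineraries_cover_def by blast
      then have "\<forall>s\<in>F \<union> G. \<rho> s x \<in> ?c (A, B) s" by auto
      then show "\<exists>C\<in>?c ` (\<A> \<times> \<B>). \<forall>s\<in>F \<union> G. \<rho> s x \<in> C s"
        using AB by (intro bexI[of _ "?c (A, B)"] imageI) auto
    qed (use \<A> \<B> in \<open>auto simp: itineraries_cover_def\<close>)
    then have "cover_number X (action_cover X \<rho> \<U> (F \<union> G)) \<le> card (?c ` (\<A> \<times> \<B>))"
      using False by (intro cover_number_le_itineraries) auto
    also have "\<dots> \<le> card (\<A> \<times> \<B>)"
      using \<A> \<B> by (intro card_image_le) (auto simp: itineraries_cover_def)
    finally have "cover_number X (action_cover X \<rho> \<U> (F \<union> G)) \<le>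
        cover_number X (action_cover X \<rho> \<U> F) * cover_number X (action_cover X \<rho> \<U> G)"
      by (simp add: \<A> \<B> card_cartesian_product)
    from order_trans[OF ln_of_nat_mono[OF this] ln_of_nat_mult_le]
    show ?thesis using False by (simp add: cover_entropy_def)
  qed (auto simp: cover_entropy_def)
next
  have cont: "\<And>s. continuous_map X X (\<rho> s)" using \<rho> by (simp add: right_action_def)
  fix F :: "'s set" and t assume fin: "finite F"
  show "cover_entropy X \<rho> \<U> ((*) t ` F) \<le> cover_entropy X \<rho> \<U> F"
  proof (cases "F = {}")
    case False
    obtain \<A> where \<A>: "itineraries_cover \<rho> \<U> F (topspace X) \<A>"
      "card \<A> = cover_number X (action_cover X \<rho> \<U> F)"
      using ex_itineraries_cover[OF X cont \<U> fin False] .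
    have "\<rho> t ` topspace X \<subseteq> topspace X" using cont by (rule continuous_map_image_subset_topspace)
    then have "itineraries_cover \<rho> \<U> F (\<rho> t ` topspace X) \<A>"
      using \<A>(1) unfolding itineraries_cover_def by blast
    from itineraries_cover_translate[OF \<rho> this] obtain \<B>
      where "itineraries_cover \<rho> \<U> ((*) t ` F) (topspace X) \<B>" "card \<B> \<le> card \<A>" .
    then have "cover_number X (action_cover X \<rho> \<U> ((*) t ` F)) \<le> cover_number X (action_cover X \<rho> \<U> F)"
      using cover_number_le_itineraries[of "(*) t ` F" \<rho> \<U> X \<B>] False \<A>(2) by simp
    from ln_of_nat_mono[OF this] show ?thesis using False by (simp add: cover_entropy_def)
  qed (simp add: cover_entropy_def)
qed


section \<open>Passing to the surjective core\<close>

locale amenable_compact_action =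
  fixes X :: "'k topology" and \<rho> :: "'s::cancellative_monoid \<Rightarrow> 'k \<Rightarrow> 'k"
  assumes amenable: "right_amenable TYPE('s)"
    and compact: "compact_space X" and Hausdorff: "Hausdorff_space X"
    and action: "right_action X \<rho>"
begin

abbreviation core :: "'k set" where "core \<equiv> surjective_core X \<rho>"

abbreviation restricted :: "'s \<Rightarrow> 'k \<Rightarrow> 'k" where "restricted \<equiv> restrict_action \<rho> core"

lemma continuous: "continuous_map X X (\<rho> s)"
  using action by (simp add: right_action_def)

lemma maps_to: "x \<in> topspace X \<Longrightarrow> \<rho> s x \<in> topspace X"
  using continuous_map_image_subset_topspace[OF continuous] by blast

lemma mult: "x \<in> topspace X \<Longrightarrow> \<rho> (s * t) x = \<rho> t (\<rho> s x)"
  using action by (simp add: right_action_def)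

section \<open>The ranges of the action and their intersection\<close>

lemma range_mult_subset: "\<rho> (s * t) ` topspace X \<subseteq> \<rho> t ` topspace X"
  using mult maps_to by auto

lemma closedin_range: "closedin X (\<rho> t ` topspace X)"
  using compact continuous Hausdorff
  by (meson compact_space_def compactin_imp_closedin image_compactin)

lemma closedin_core: "closedin X core"
  unfolding surjective_core_def by (intro closedin_Inter) (auto simp: closedin_range)

lemma core_subset: "core \<subseteq> topspace X"
  by (rule closedin_subset) (rule closedin_core)

text \<open>Given \<open>t\<close>, pick \<open>b * s = a * t\<close> and write
  \<open>x = \<rho> b y\<close>; then \<open>\<rho> s x = \<rho> t (\<rho> a y)\<close> lies in the
  range of \<open>\<rho> t\<close>.\<close>

lemma core_invariant:
  assumes "x \<in> core"
  shows "\<rho> s x \<in> core"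
  unfolding surjective_core_def
proof
  fix t
  obtain a b where ab: "b * s = a * t" using ex_common_left_multiple[OF amenable] by metis
  obtain y where y: "y \<in> topspace X" "x = \<rho> b y"
    using assms unfolding surjective_core_def by blast
  then have "\<rho> s x = \<rho> t (\<rho> a y)" using mult ab by metis
  then show "\<rho> s x \<in> \<rho> t ` topspace X" using maps_to y by blast
qed

text \<open>A left multiple of \<open>s\<close> has a smaller range than \<open>s\<close>, so common
  left multiples make the ranges downward directed.\<close>

lemma ex_range_subset_all:
  "finite T \<Longrightarrow> \<exists>t. \<forall>s\<in>T. \<rho> t ` topspace X \<subseteq> \<rho> s ` topspace X"
proof (induction T rule: finite_induct)
  case (insert s T)
  then obtain t where t: "\<forall>s\<in>T. \<rho> t ` topspace X \<subseteq> \<rho> s ` topspace X" by blast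
  obtain a b where "a * s = b * t" using ex_common_left_multiple[OF amenable] by blast
  then have "\<rho> (a * s) ` topspace X \<subseteq> \<rho> t ` topspace X" using range_mult_subset by metis
  then show ?case using t range_mult_subset[of a s] by (intro exI[of _ "a * s"]) blast
qed simp

text \<open>\<open>W\<close> and the complements of the closed ranges cover \<open>X\<close>. A
  finite subcover involves finitely many ranges, and directedness replaces their intersection by a
  single one.\<close>

lemma ex_range_subset_nbhd:
  assumes "openin X W" "core \<subseteq> W"
  shows "\<exists>t. \<rho> t ` topspace X \<subseteq> W"
proof -
  let ?\<C> = "insert W (range (\<lambda>t. topspace X - \<rho> t ` topspace X))"
  have "\<forall>U\<in>?\<C>. openin X U" using assms(1) closedin_range by auto
  moreover have "topspace X \<subseteq> \<Union>?\<C>"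
    using assms(2) unfolding surjective_core_def by auto
  ultimately obtain \<F> where \<F>: "finite \<F>" "\<F> \<subseteq> ?\<C>" "topspace X \<subseteq> \<Union>\<F>"
    using compact unfolding compact_space_alt by meson
  have "finite (\<F> - {W})" "\<F> - {W} \<subseteq> range (\<lambda>t. topspace X - \<rho> t ` topspace X)" using \<F> by auto
  then obtain T where T: "finite T" "\<F> - {W} = (\<lambda>t. topspace X - \<rho> t ` topspace X) ` T"
    by (meson finite_subset_image)
  obtain t where t: "\<forall>s\<in>T. \<rho> t ` topspace X \<subseteq> \<rho> s ` topspace X" using ex_range_subset_all[OF T(1)] by blast
  have "\<rho> t ` topspace X \<subseteq> W"
  proof
    fix y assume y: "y \<in> \<rho> t ` topspace X"
    then have "y \<in> \<Union>\<F>" using \<F>(3) maps_to by blast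
    then obtain U where U: "U \<in> \<F>" "y \<in> U" by blast
    show "y \<in> W"
    proof (rule ccontr)
      assume "y \<notin> W"
      then have "U \<in> \<F> - {W}" using U by auto
      then obtain s where s: "s \<in> T" "U = topspace X - \<rho> s ` topspace X" unfolding T(2) by auto
      then have "y \<in> \<rho> s ` topspace X" using t y by blast
      then show False using U(2) s(2) by simp
    qed
  qed
  then show ?thesis ..
qed

section \<open>Restricting the action and its covers to the core\<close>

lemma topspace_core: "topspace (subtopology X core) = core"
  using core_subset by auto

lemma compact_core: "compact_space (subtopology X core)"
  using compact closedin_core by (simp add: closedin_compact_space compact_space_subtopology)

lemma continuous_restricted: "continuous_map (subtopology X core) (subtopology X core) (restricted s)"
proof -
  have "continuous_map (subtopology X core) (subtopology X core) (\<rho> s)"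
    using continuous core_invariant
    by (auto simp: continuous_map_in_subtopology continuous_map_from_subtopology)
  then show ?thesis
    by (rule continuous_map_eq) (simp add: restrict_action_def)
qed

lemma restricted_eq: "x \<in> core \<Longrightarrow> restricted s x = \<rho> s x"
  by (simp add: restrict_action_def)

lemma open_cover_core:
  assumes "open_cover X \<U>"
  shows "open_cover (subtopology X core) ((\<lambda>U. U \<inter> core) ` \<U>)"
  using assms core_subset unfolding open_cover_def topspace_core
  by (auto simp: openin_subtopology)

lemma cover_entropy_core_le:
  assumes \<U>: "open_cover X \<U>" and F: "finite F"
  shows "cover_entropy (subtopology X core) restricted ((\<lambda>U. U \<inter> core) ` \<U>) F
    \<le> cover_entropy X \<rho> \<U> F"
proof (cases "F = {}")
  case False
  obtain \<A> where \<A>: "itineraries_cover \<rho> \<U> F (topspace X) \<A>"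
    "card \<A> = cover_number X (action_cover X \<rho> \<U> F)"
    using ex_itineraries_cover[OF compact continuous \<U> F False] .
  let ?\<B> = "(\<lambda>A s. A s \<inter> core) ` \<A>"
  have "itineraries_cover restricted ((\<lambda>U. U \<inter> core) ` \<U>) F core ?\<B>"
    unfolding itineraries_cover_def
  proof (intro conjI ballI)
    fix x assume x: "x \<in> core"
    then obtain A where A: "A \<in> \<A>" "\<forall>s\<in>F. \<rho> s x \<in> A s"
      using \<A>(1) core_subset unfolding itineraries_cover_def by blast
    then have "\<forall>s\<in>F. restricted s x \<in> A s \<inter> core"
      using x core_invariant by (simp add: restricted_eq)
    then show "\<exists>B\<in>?\<B>. \<forall>s\<in>F. restricted s x \<in> B s"
      using A(1) by (intro bexI[of _ "\<lambda>s. A s \<inter> core"]) auto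
  qed (use \<A> in \<open>auto simp: itineraries_cover_def\<close>)
  then have "cover_number (subtopology X core)
      (action_cover (subtopology X core) restricted ((\<lambda>U. U \<inter> core) ` \<U>) F) \<le> card ?\<B>"
    by (intro cover_number_le_itineraries False) (simp only: topspace_core)
  also have "\<dots> \<le> card \<A>" using \<A>(1) by (intro card_image_le) (simp add: itineraries_cover_def)
  finally show ?thesis using False \<A>(2) by (simp add: cover_entropy_def ln_of_nat_mono)
qed (simp add: cover_entropy_def)

lemma ex_translate_cover_entropy_le:
  assumes \<U>: "open_cover X \<U>" and F: "finite F"
  shows "\<exists>t. cover_entropy X \<rho> \<U> ((*) t ` F)
    \<le> cover_entropy (subtopology X core) restricted ((\<lambda>U. U \<inter> core) ` \<U>) F"
proof (cases "F = {}")
  case False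
  let ?\<V> = "(\<lambda>U. U \<inter> core) ` \<U>"
  obtain \<A> where \<A>: "itineraries_cover restricted ?\<V> F core \<A>"
    "card \<A> = cover_number (subtopology X core) (action_cover (subtopology X core) restricted ?\<V> F)"
    using ex_itineraries_cover[OF compact_core continuous_restricted open_cover_core[OF \<U>] F False]
    unfolding topspace_core .
  have "\<forall>V\<in>?\<V>. \<exists>U\<in>\<U>. V = U \<inter> core" by blast
  then have "\<forall>V\<in>?\<V>. \<exists>U. U \<in> \<U> \<and> V = U \<inter> core" by blast
  \<comment> \<open>\<open>l\<close> lifts each trace on the core to a member of the original
    cover.\<close>
  from bchoice[OF this] obtain l where l: "\<forall>V\<in>?\<V>. l V \<in> \<U> \<and> V = l V \<inter> core" ..
  let ?\<B> = "(\<lambda>A s. l (A s)) ` \<A>"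
  have l\<A>: "l (A s) \<in> \<U>" "A s \<subseteq> l (A s)" if "A \<in> \<A>" "s \<in> F" for A s
  proof -
    have "A s \<in> ?\<V>" using \<A>(1) that unfolding itineraries_cover_def by blast
    from bspec[OF l this] show "l (A s) \<in> \<U>" "A s \<subseteq> l (A s)" by auto
  qed
  \<comment> \<open>The points of \<open>X\<close> that follow some lifted itinerary: an open set,
    as \<open>F\<close> is finite, which contains the core and hence some range.\<close>
  define W where "W = (\<Union>A\<in>\<A>. \<Inter>s\<in>F. {x \<in> topspace X. \<rho> s x \<in> l (A s)})"
  have "openin X {x \<in> topspace X. \<rho> s x \<in> l (A s)}" if "A \<in> \<A>" "s \<in> F" for A s
    using \<U> l\<A>(1)[OF that]
    by (intro openin_continuous_map_preimage[OF continuous]) (simp add: open_cover_def)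
  then have "openin X (\<Inter>s\<in>F. {x \<in> topspace X. \<rho> s x \<in> l (A s)})" if "A \<in> \<A>" for A
    using F False that by (intro openin_INT2) auto
  then have "openin X W" unfolding W_def by blast
  moreover have "core \<subseteq> W"
  proof
    fix x assume x: "x \<in> core"
    then obtain A where A: "A \<in> \<A>" "\<forall>s\<in>F. \<rho> s x \<in> A s"
      using \<A>(1) x unfolding itineraries_cover_def by (auto simp: restricted_eq)
    then show "x \<in> W" using l\<A>(2) x core_subset unfolding W_def by blast
  qed
  ultimately obtain t where t: "\<rho> t ` topspace X \<subseteq> W" using ex_range_subset_nbhd by blast
  have "itineraries_cover \<rho> \<U> F (\<rho> t ` topspace X) ?\<B>"
    unfolding itineraries_cover_def
  proof (intro conjI ballI)
    fix x assume "x \<in> \<rho> t ` topspace X"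
    then obtain A where "A \<in> \<A>" "\<forall>s\<in>F. \<rho> s x \<in> l (A s)" using t unfolding W_def by blast
    then show "\<exists>B\<in>?\<B>. \<forall>s\<in>F. \<rho> s x \<in> B s" by (intro bexI[of _ "\<lambda>s. l (A s)"]) auto
  qed (use l\<A> \<A> in \<open>auto simp: itineraries_cover_def\<close>)
  from itineraries_cover_translate[OF action this] obtain \<C>
    where \<C>: "itineraries_cover \<rho> \<U> ((*) t ` F) (topspace X) \<C>" "card \<C> \<le> card ?\<B>" .
  have "cover_number X (action_cover X \<rho> \<U> ((*) t ` F)) \<le> card \<C>"
    using False \<C>(1) by (intro cover_number_le_itineraries) auto
  also have "\<dots> \<le> card ?\<B>" by fact
  also have "\<dots> \<le> card \<A>" using \<A>(1) by (intro card_image_le) (simp add: itineraries_cover_def)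
  finally show ?thesis
    using False \<A>(2) by (intro exI[of _ t]) (simp add: cover_entropy_def ln_of_nat_mono)
qed (simp add: cover_entropy_def)

text \<open>The core quotient is squeezed between the quotient of the full action along the
  translated net and the one along the net itself. Translation preserves cardinality, so the
  denominators agree.\<close>

lemma is_Folner_limit_core:
  assumes \<U>: "open_cover X \<U>"
    and l: "is_Folner_limit (\<lambda>F. cover_entropy X \<rho> \<U> F / real (card F)) l"
  shows "is_Folner_limit (\<lambda>F. cover_entropy (subtopology X core) restricted
      ((\<lambda>U. U \<inter> core) ` \<U>) F / real (card F)) l"
  unfolding is_Folner_limit_def
proof (intro allI impI)
  let ?f = "cover_entropy X \<rho> \<U>"
  let ?g = "cover_entropy (subtopology X core) restricted ((\<lambda>U. U \<inter> core) ` \<U>)"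
  fix I :: "('s set \<times> nat) set" and r and F :: "_ \<Rightarrow> 's set"
  assume F: "right_Folner_net I r F"
  obtain t where t: "\<And>A. finite A \<Longrightarrow> ?f ((*) (t A) ` A) \<le> ?g A"
    using ex_translate_cover_entropy_le[OF \<U>] by metis
  have dir: "directed_preorder_on I r" and fin: "\<And>i. i \<in> I \<Longrightarrow> finite (F i)"
    using F by (auto simp: right_Folner_net_def)
  have I: "eventually (\<lambda>i. i \<in> I) (net_filter I r)"
    using dir unfolding eventually_net_filter[OF dir] directed_preorder_on_def by blast
  show "((\<lambda>i. ?g (F i) / real (card (F i))) \<longlongrightarrow> l) (net_filter I r)"
  proof (rule tendsto_sandwich)
    show "eventually (\<lambda>i. ?g (F i) / real (card (F i)) \<le> ?f (F i) / real (card (F i))) (net_filter I r)"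
      by (rule eventually_mono[OF I]) (simp add: cover_entropy_core_le[OF \<U>] fin divide_right_mono)
    show "eventually (\<lambda>i. ?f ((*) (t (F i)) ` F i) / real (card (F i)) \<le> ?g (F i) / real (card (F i)))
        (net_filter I r)"
      by (rule eventually_mono[OF I]) (simp add: t fin divide_right_mono)
    show "((\<lambda>i. ?f (F i) / real (card (F i))) \<longlongrightarrow> l) (net_filter I r)"
      using l F unfolding is_Folner_limit_def by blast
    have "((\<lambda>i. ?f ((*) (t (F i)) ` F i) / real (card ((*) (t (F i)) ` F i))) \<longlongrightarrow> l) (net_filter I r)"
      using l right_Folner_net_left_translate[OF F, of "\<lambda>i. t (F i)"]
      unfolding is_Folner_limit_def by blast
    then show "((\<lambda>i. ?f ((*) (t (F i)) ` F i) / real (card (F i))) \<longlongrightarrow> l) (net_filter I r)"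
      by simp
  qed
qed

section \<open>Comparing the two entropies\<close>

text \<open>Uniqueness rests on amenability: without any Foelner net every real number would be a
  limit.\<close>

lemma the_Folner_limit:
  fixes \<phi> :: "'s set \<Rightarrow> real"
  assumes "is_Folner_limit \<phi> l"
  shows "(THE h. is_Folner_limit \<phi> h) = l"
proof (rule the_equality[of "is_Folner_limit \<phi>", OF assms])
  fix h assume h: "is_Folner_limit \<phi> h"
  obtain I :: "('s set \<times> nat) set" and r and F :: "_ \<Rightarrow> 's set"
    where F: "right_Folner_net I r F" "net_filter I r \<noteq> bot"
    using right_amenableE[OF amenable] by blast
  then show "h = l"
    using assms h tendsto_unique[OF F(2)] unfolding is_Folner_limit_def by blast
qed

text \<open>The Ornstein-Weiss limit is taken once, for the full action, and then transferred to the
  core.\<close>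

lemma H_top_core:
  assumes \<U>: "open_cover X \<U>"
  shows "H_top (subtopology X core) restricted ((\<lambda>U. U \<inter> core) ` \<U>) = H_top X \<rho> \<U>"
proof -
  obtain l where "is_Folner_limit (\<lambda>F. cover_entropy X \<rho> \<U> F / real (card F)) l"
    using subadditive_set_function.ex_Folner_limit[OF subadditive_cover_entropy[OF compact action \<U>] amenable]
    by blast
  then show ?thesis
    using is_Folner_limit_core[OF \<U>] by (simp add: H_top_eq_cover_entropy the_Folner_limit)
qed

text \<open>Adding the open complement of the core to an open extension leaves its trace unchanged,
  so the open sets with trace in \<open>\<V>\<close> also reach the points outside the core.\<close>

lemma ex_open_cover_extension:
  assumes \<V>: "open_cover (subtopology X core) \<V>"
  shows "\<exists>\<U>. open_cover X \<U> \<and> \<V> = (\<lambda>U. U \<inter> core) ` \<U>"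
proof (intro exI conjI)
  let ?\<U> = "{W. openin X W \<and> W \<inter> core \<in> \<V>}"
  have \<V>': "\<Union>\<V> = core" "\<And>V. V \<in> \<V> \<Longrightarrow> \<exists>W. openin X W \<and> V = W \<inter> core"
    using \<V> unfolding open_cover_def topspace_core openin_subtopology by blast+
  then show "\<V> = (\<lambda>U. U \<inter> core) ` ?\<U>" by blast
  have "x \<in> \<Union>?\<U>" if x: "x \<in> topspace X" for x
  proof -
    \<comment> \<open>An empty core would have the empty set as neighbourhood and so force some
      range to be empty. Nonemptiness supplies a \<open>V\<close> even when \<open>x\<close> is
      outside the core.\<close>
    have "core \<noteq> {}" using ex_range_subset_nbhd[of "{}"] x by auto
    then obtain V where "V \<in> \<V>" "x \<in> core \<longrightarrow> x \<in> V" using \<V>'(1) by blast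
    then obtain W where W: "openin X W" "V = W \<inter> core" "x \<in> core \<longrightarrow> x \<in> W" using \<V>'(2) by blast
    have "openin X (W \<union> (topspace X - core))" using W closedin_core by auto
    moreover have "(W \<union> (topspace X - core)) \<inter> core = V" using W by auto
    ultimately have "W \<union> (topspace X - core) \<in> ?\<U>" using \<open>V \<in> \<V>\<close> by simp
    then show ?thesis using x W(3) by blast
  qed
  then show "open_cover X ?\<U>"
    unfolding open_cover_def using openin_subset by blast
qed

text \<open>The open covers of the core are exactly the traces of open covers of \<open>X\<close>,
  so both suprema run over the same values.\<close>

lemma h_top_core: "h_top (subtopology X core) restricted = h_top X \<rho>"
proof -
  have "{\<V>. open_cover (subtopology X core) \<V>} = (\<lambda>\<U>. (\<lambda>U. U \<inter> core) ` \<U>) ` {\<U>. open_cover X \<U>}"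
    using open_cover_core ex_open_cover_extension by blast
  then show ?thesis
    unfolding h_top_def by (simp only: image_image) (intro SUP_cong; simp add: H_top_core)
qed

end

theorem theorem3p10:
  fixes X :: "'k topology"
    and \<rho> :: "'s::cancellative_monoid \<Rightarrow> 'k \<Rightarrow> 'k"
  assumes "right_amenable TYPE('s)"
    and "compact_space X" and "Hausdorff_space X"
    and "right_action X \<rho>"
  shows "h_top X \<rho> =
    h_top (subtopology X (surjective_core X \<rho>)) (restrict_action \<rho> (surjective_core X \<rho>))"
proof -
  interpret amenable_compact_action X \<rho>
    using assms by unfold_locales
  show ?thesis by (rule h_top_core[symmetric])
qed

end
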